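(* Let $\phi(q)=\sum_{n=0}^\infty \frac{q^{n^2}}{(-q^2;q^2)_n}$, and for $n\ge1$ let $p^e_{do}(n)$ denote the number of partitions of $n$ into an even number of distinct parts with the smallest part being odd. Then \[ (-q;q)_\infty\,\phi(-q)=1+2\sum_{n\ge 1}p^e_{do}(n)q^n. \]
   Context: Notation: $(a;q)_n=(1-a)(1-aq)\cdots(1-aq^{n-1})$ and $(a;q)_\infty=\prod_{n\ge 0}(1-aq^n)$, $|q|<1$. *)

theory Defs
  imports "HOL-Analysis.Analysis" "HOL-Library.Multiset"
begin

definition qpoch :: "complex \<Rightarrow> complex \<Rightarrow> nat \<Rightarrow> complex" where
  "qpoch a q n = (\<Prod>k<n. 1 - a * q ^ k)"

definition qpoch_inf :: "complex \<Rightarrow> complex \<Rightarrow> complex" where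
  "qpoch_inf a q = (\<Prod>k. 1 - a * q ^ k)"

definition phi :: "complex \<Rightarrow> complex" where
  "phi q = (\<Sum>n. q ^ (n\<^sup>2) / qpoch (- (q\<^sup>2)) (q\<^sup>2) n)"

definition partitions :: "nat \<Rightarrow> nat multiset set" where
  "partitions n = {M. 0 \<notin># M \<and> sum_mset M = n}"

(* Meaningful only for n \<ge> 1: the empty partition has no smallest part. *)
definition p_do_e :: "nat \<Rightarrow> nat" where
  "p_do_e n = card {M \<in> partitions n.
     (\<forall>k\<in>#M. count M k = 1) \<and> even (size M) \<and> odd (Min (set_mset M))}"


text \<open>For \<open>norm q < 1\<close> the infinite products and series involved converge,
  and \<open>p_do_e\<close> counts a finite set, so none of the definitions falls back on a default value.\<close>

lemma convergent_prod_qpoch_inf: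
  assumes "norm q < 1"
  shows "convergent_prod (\<lambda>k. 1 - a * q ^ k :: complex)"
proof -
  have "summable (\<lambda>k. norm a * norm q ^ k)"
    using assms by (intro summable_mult summable_geometric) auto
  then show ?thesis
    by (intro abs_convergent_prod_imp_convergent_prod)
       (simp add: abs_convergent_prod_conv_summable norm_mult norm_power)
qed

lemma qpoch_phi_factor_nonzero:
  assumes "norm q < 1"
  shows "1 - (- (q\<^sup>2)) * (q\<^sup>2) ^ k \<noteq> (0 :: complex)"
proof
  assume "1 - (- (q\<^sup>2)) * (q\<^sup>2) ^ k = 0"
  then have "(q\<^sup>2) ^ Suc k = - 1"
    by (simp add: eq_neg_iff_add_eq_0 add.commute)
  then have "norm ((q\<^sup>2) ^ Suc k) = 1"
    by (simp del: power_Suc)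
  moreover have "norm ((q\<^sup>2) ^ Suc k) < 1"
    using assms by (simp add: norm_power power_mult [symmetric] power_less_one_iff del: power_Suc)
  ultimately show False by simp
qed

lemma summable_phi:
  assumes "norm q < 1"
  shows "summable (\<lambda>n. q ^ (n\<^sup>2) / qpoch (- (q\<^sup>2)) (q\<^sup>2) n)"
proof -
  define f where "f = (\<lambda>k. 1 - (- (q\<^sup>2)) * (q\<^sup>2) ^ k)"
  have "norm (q\<^sup>2) < 1"
    using assms by (simp add: norm_power power_less_one_iff)
  then have conv: "convergent_prod f"
    unfolding f_def by (rule convergent_prod_qpoch_inf)
  have nz: "f k \<noteq> 0" for k
    unfolding f_def by (rule qpoch_phi_factor_nonzero [OF assms])
  have "(\<lambda>n. \<Prod>k<n. f k) \<longlonglongrightarrow> prodinf f"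
    using convergent_prod_LIMSEQ [OF conv]
    by (subst filterlim_sequentially_Suc [symmetric]) (simp add: lessThan_Suc_atMost)
  then have "(\<lambda>n. inverse (\<Prod>k<n. f k)) \<longlonglongrightarrow> inverse (prodinf f)"
    by (rule tendsto_inverse) (rule prodinf_nonzero [OF conv nz])
  then have "Bseq (\<lambda>n. inverse (\<Prod>k<n. f k))"
    by (intro convergent_imp_Bseq) (auto simp: convergent_def)
  then obtain C where C: "\<And>n. norm (inverse (\<Prod>k<n. f k)) \<le> C"
    by (auto simp: Bseq_def)
  show ?thesis
  proof (rule summable_comparison_test')
    show "summable (\<lambda>n. C * norm q ^ n)"
      using assms by (intro summable_mult summable_geometric) auto
    fix n :: nat
    have "norm (q ^ (n\<^sup>2) / qpoch (- (q\<^sup>2)) (q\<^sup>2) n)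
        = norm (inverse (\<Prod>k<n. f k)) * norm q ^ (n\<^sup>2)"
      by (simp add: qpoch_def f_def divide_inverse norm_mult norm_power)
    also have "\<dots> \<le> C * norm q ^ n"
    proof (rule mult_mono)
      show "norm q ^ (n\<^sup>2) \<le> norm q ^ n"
        using assms by (intro power_decreasing) (auto simp: power2_eq_square)
    qed (use C order_trans [OF norm_ge_zero C] in auto)
    finally show "norm (q ^ (n\<^sup>2) / qpoch (- (q\<^sup>2)) (q\<^sup>2) n) \<le> C * norm q ^ n" .
  qed
qed

lemma distinct_partition_eq:
  assumes "M \<in> partitions n" "\<forall>k\<in>#M. count M k = 1"
  shows "mset_set (set_mset M) = M" "set_mset M \<subseteq> {1..n}" "\<Sum>(set_mset M) = n"
proof -
  show eq: "mset_set (set_mset M) = M"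
    by (rule multiset_eqI) (metis assms(2) count_eq_zero_iff count_mset_set(1,3) finite_set_mset)
  have "\<Sum>(set_mset M) = sum_mset (mset_set (set_mset M))"
    by (simp add: sum_unfold_sum_mset)
  also have "\<dots> = n"
    using assms(1) by (simp add: eq partitions_def)
  finally show "\<Sum>(set_mset M) = n" .
  then have "k \<le> n" if "k \<in># M" for k
    using member_le_sum [of k "set_mset M" "\<lambda>k. k"] that by simp
  moreover have "k \<ge> 1" if "k \<in># M" for k
    using assms(1) that by (cases k) (auto simp: partitions_def)
  ultimately show "set_mset M \<subseteq> {1..n}" by auto
qed

lemma distinct_partitions_finite_card:
  fixes n :: nat
  defines "A \<equiv> {S \<in> Pow {1..n}. \<Sum>S = n}"
  shows "finite {M \<in> partitions n. (\<forall>k\<in>#M. count M k = 1) \<and> P M}"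
    and "card {M \<in> partitions n. (\<forall>k\<in>#M. count M k = 1) \<and> P M} \<le> card A"
proof -
  let ?D = "{M \<in> partitions n. (\<forall>k\<in>#M. count M k = 1) \<and> P M}"
  have sub: "?D \<subseteq> mset_set ` A"
  proof
    fix M assume "M \<in> ?D"
    then have "mset_set (set_mset M) = M" "set_mset M \<in> A"
      using distinct_partition_eq [of M n] by (auto simp: A_def)
    then show "M \<in> mset_set ` A" by (metis imageI)
  qed
  have fin: "finite A"
    by (simp add: A_def)
  show "finite ?D"
    by (rule finite_subset [OF sub]) (use fin in simp)
  show "card ?D \<le> card A"
    using surj_card_le [OF fin sub] .
qed

lemma finite_p_do_e:
  "finite {M \<in> partitions n.
     (\<forall>k\<in>#M. count M k = 1) \<and> even (size M) \<and> odd (Min (set_mset M))}"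
  by (rule distinct_partitions_finite_card)

lemma abs_summable_p_do_e:
  assumes "norm (q :: complex) < 1"
  shows "(\<lambda>n. norm (of_nat (p_do_e n) * q ^ n)) summable_on {1..}"
proof (rule nonneg_bdd_above_summable_on)
  define r where "r = norm q"
  have r: "0 \<le> r" "r < 1"
    using assms by (auto simp: r_def)
  show "bdd_above (sum (\<lambda>n. norm (of_nat (p_do_e n) * q ^ n)) ` {F. F \<subseteq> {1..} \<and> finite F})"
  proof (rule bdd_aboveI2)
    fix F :: "nat set" assume "F \<in> {F. F \<subseteq> {1..} \<and> finite F}"
    then have F: "finite F" by simp
    define N where "N = Max (insert 0 F)"
    have N: "n \<le> N" if "n \<in> F" for n
      using F that by (simp add: N_def)
    define A where "A = (\<lambda>n::nat. {S \<in> Pow {1..n}. \<Sum>S = n})"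
    have "(\<Sum>n\<in>F. norm (of_nat (p_do_e n) * q ^ n)) = (\<Sum>n\<in>F. real (p_do_e n) * r ^ n)"
      by (simp add: norm_mult norm_power r_def)
    also have "\<dots> \<le> (\<Sum>n\<in>F. real (card (A n)) * r ^ n)"
      unfolding p_do_e_def A_def using r
      by (intro sum_mono mult_right_mono of_nat_mono distinct_partitions_finite_card) auto
    also have "\<dots> = (\<Sum>n\<in>F. \<Sum>S\<in>A n. r ^ (\<Sum>S))"
      by (intro sum.cong refl) (simp add: A_def)
    also have "\<dots> = (\<Sum>S\<in>(\<Union>n\<in>F. A n). r ^ (\<Sum>S))"
      using F by (intro sum.UNION_disjoint [symmetric]) (auto simp: A_def)
    also have "\<dots> \<le> (\<Sum>S\<in>Pow {1..N}. r ^ (\<Sum>S))"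
    proof (intro sum_mono2)
      show "(\<Union>n\<in>F. A n) \<subseteq> Pow {1..N}"
        using N by (force simp: A_def)
    qed (use r in auto)
    also have "\<dots> = (\<Prod>k\<in>{1..N}. r ^ k + 1)"
      by (subst prod_add) (simp_all add: power_sum)
    also have "\<dots> \<le> exp (\<Sum>k\<in>{1..N}. r ^ k)"
      using prod_le_exp_sum [of "{1..N}" "\<lambda>k. r ^ k"] r by (simp add: add.commute)
    also have "\<dots> \<le> exp (\<Sum>k. r ^ k)"
      using r by (intro exp_le_cancel_iff [THEN iffD2] sum_le_suminf summable_geometric) auto
    finally show "(\<Sum>n\<in>F. norm (of_nat (p_do_e n) * q ^ n)) \<le> exp (\<Sum>k. r ^ k)" .
  qed
qed auto

end

theory Submission
  imports Defs
begin

text \<open>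
  Put \<open>p = q\<^sup>2\<close> and \<open>E(z) = (z; p)\<^sub>\<infinity>\<close>. Adding 1 to every part shows that partitions into \<open>m\<close> distinct
  parts with odd smallest part have generating function \<open>q\<close> to the \<open>m(m+1)/2\<close>, divided by
  \<open>(q; q)\<^sub>m (1 + q^m)\<close>. Summing over even \<open>m = 2j\<close>, the right-hand side of the theorem becomes
  \<open>2 A(q) / E(q)\<close>, where \<open>A(z) = \<Sum> p^(j\<^sup>2) z^j E(z p^j) / ((p; p)\<^sub>j (1 + p^j))\<close>. By Euler,
  \<open>(-q; q)\<^sub>\<infinity> E(q) = 1\<close>, so it remains to see that \<open>\<phi>(-q) = 2 A(q)\<close>.

  Replace \<open>\<phi>(-q)\<close> by \<open>B(z) = \<Sum> (-z)^n p^(n(n-1)/2) / (-p; p)\<^sub>n\<close>, which is \<open>\<phi>(-q)\<close> at \<open>z = q\<close>. Both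
  \<open>F = 2 A\<close> and \<open>F = B\<close> satisfy \<open>F(z) + (1 + z) F(z p) = 2\<close>, and both tend to 1 along \<open>z p^k\<close>; this
  determines \<open>F\<close>. For \<open>A\<close> the factor \<open>1 + p^j\<close> cancels and the equation reduces to the Durfee square
  identity \<open>W(u) = \<Sum> p^(j(j-1)) u^j E(u p^j) / (p; p)\<^sub>j = 1\<close>, which follows in the same way from
  \<open>W(u) - W(u p) = - u (W(u p) - W(u p\<^sup>2))\<close>.
\<close>

section \<open>The q-Pochhammer symbol\<close>

lemma qpoch_0 [simp]: "qpoch a q 0 = 1"
  by (simp add: qpoch_def)

lemma qpoch_Suc: "qpoch a q (Suc n) = qpoch a q n * (1 - a * q ^ n)"
  by (simp add: qpoch_def)

lemma qpoch_tendsto_qpoch_inf: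
  assumes "norm q < 1"
  shows "qpoch a q \<longlonglongrightarrow> qpoch_inf a q"
  using convergent_prod_LIMSEQ [OF convergent_prod_qpoch_inf [OF assms, of a]]
  by (subst filterlim_sequentially_Suc [symmetric])
     (simp add: qpoch_def [abs_def] qpoch_inf_def lessThan_Suc_atMost)

lemma qpoch_inf_rec:
  assumes "norm q < 1"
  shows "qpoch_inf a q = (1 - a) * qpoch_inf (a * q) q"
proof (rule LIMSEQ_unique)
  show "(\<lambda>n. qpoch a q (Suc n)) \<longlonglongrightarrow> qpoch_inf a q"
    using qpoch_tendsto_qpoch_inf [OF assms] by (rule LIMSEQ_Suc)
  have "qpoch a q (Suc n) = (1 - a) * qpoch (a * q) q n" for n
    unfolding qpoch_def by (subst prod.lessThan_Suc_shift) (simp add: mult_ac)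
  then show "(\<lambda>n. qpoch a q (Suc n)) \<longlonglongrightarrow> (1 - a) * qpoch_inf (a * q) q"
    by (simp add: tendsto_mult_left qpoch_tendsto_qpoch_inf [OF assms])
qed

lemma qpoch_mult_qpoch_inf:
  assumes "norm q < 1"
  shows "qpoch a q n * qpoch_inf (a * q ^ n) q = qpoch_inf a q"
proof (induction n)
  case (Suc n)
  have "qpoch_inf (a * q ^ n) q = (1 - a * q ^ n) * qpoch_inf (a * q ^ Suc n) q"
    by (subst qpoch_inf_rec [OF assms]) (simp add: mult_ac)
  with Suc show ?case by (simp add: qpoch_Suc mult_ac)
qed simp

text \<open>Expanding the finite product termwise compares it with the product of
  \<open>1 + norm a * norm q ^ k\<close>, which is at most the exponential of a geometric series.
  The bound vanishes with \<open>a\<close> and is uniform on bounded sets of \<open>a\<close>; both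
  facts are used below.\<close>

lemma norm_qpoch_inf_minus_one_le:
  assumes "norm q < 1"
  shows "norm (qpoch_inf a q - 1) \<le> exp (norm a / (1 - norm q)) - 1"
proof (rule tendsto_upperbound)
  show "(\<lambda>n. norm (qpoch a q n - 1)) \<longlonglongrightarrow> norm (qpoch_inf a q - 1)"
    by (intro tendsto_intros qpoch_tendsto_qpoch_inf assms)
  have "norm (qpoch a q n - 1) \<le> exp (norm a / (1 - norm q)) - 1" for n
  proof -
    have "norm (qpoch a q n - 1) \<le> (\<Prod>k<n. 1 + norm a * norm q ^ k) - 1"
      using norm_prod_minus1_le_prod_minus1 [of "\<lambda>k. - (a * q ^ k)" "{..<n}"]
      by (simp add: qpoch_def norm_mult norm_power)
    also have "(\<Prod>k<n. 1 + norm a * norm q ^ k) \<le> exp (\<Sum>k<n. norm a * norm q ^ k)"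
      by (rule prod_le_exp_sum) auto
    also have "(\<Sum>k<n. norm a * norm q ^ k) \<le> (\<Sum>k. norm a * norm q ^ k)"
      using assms by (intro sum_le_suminf summable_mult summable_geometric) auto
    also have "\<dots> = norm a / (1 - norm q)"
      using assms by (simp add: suminf_mult suminf_geometric summable_geometric)
    finally show ?thesis by simp
  qed
  then show "\<forall>\<^sub>F n in sequentially. norm (qpoch a q n - 1) \<le> exp (norm a / (1 - norm q)) - 1"
    by simp
qed simp

lemma qpoch_inf_scaled_tendsto_1:
  assumes "norm q < 1"
  shows "(\<lambda>k. qpoch_inf (a * q ^ k) q) \<longlonglongrightarrow> 1"
proof -
  have "(\<lambda>k. exp (norm a * norm q ^ k / (1 - norm q)) - 1) \<longlonglongrightarrow> exp (norm a * 0 / (1 - norm q)) - 1"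
    using assms by (intro tendsto_intros LIMSEQ_realpow_zero) auto
  then have "(\<lambda>k. exp (norm a * norm q ^ k / (1 - norm q)) - 1) \<longlonglongrightarrow> 0"
    by simp
  then have "(\<lambda>k. qpoch_inf (a * q ^ k) q - 1) \<longlonglongrightarrow> 0"
  proof (rule Lim_null_comparison [rotated])
    show "\<forall>\<^sub>F k in sequentially. norm (qpoch_inf (a * q ^ k) q - 1)
        \<le> exp (norm a * norm q ^ k / (1 - norm q)) - 1"
      using norm_qpoch_inf_minus_one_le [OF assms, of "a * q ^ k" for k]
      by (simp add: norm_mult norm_power)
  qed
  then show ?thesis by (simp add: LIM_zero_iff)
qed

lemma norm_qpoch_inf_le:
  assumes "norm q < 1" "norm a \<le> 1"
  shows "norm (qpoch_inf a q) \<le> exp (1 / (1 - norm q))"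
proof -
  have "norm (qpoch_inf a q) \<le> norm (qpoch_inf a q - 1) + 1"
    using norm_triangle_ineq [of "qpoch_inf a q - 1" 1] by simp
  also have "\<dots> \<le> exp (norm a / (1 - norm q))"
    using norm_qpoch_inf_minus_one_le [OF assms(1), of a] by simp
  also have "\<dots> \<le> exp (1 / (1 - norm q))"
    using assms by (simp add: divide_right_mono)
  finally show ?thesis .
qed

lemma one_minus_mult_power_nonzero:
  fixes a q :: complex
  assumes "norm q < 1" "norm a < 1"
  shows "1 - a * q ^ k \<noteq> 0"
proof
  assume "1 - a * q ^ k = 0"
  then have "norm (a * q ^ k) = 1" by simp
  moreover have "norm (a * q ^ k) \<le> norm a * 1"
    unfolding norm_mult norm_power using assms by (intro mult_left_mono power_le_one) auto
  ultimately show False using assms by simp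
qed

lemma qpoch_nonzero:
  assumes "norm q < 1" "norm a < 1"
  shows "qpoch a q n \<noteq> 0"
  using one_minus_mult_power_nonzero [OF assms] by (simp add: qpoch_def)

lemma qpoch_inf_nonzero:
  assumes "norm q < 1" "norm a < 1"
  shows "qpoch_inf a q \<noteq> 0"
  unfolding qpoch_inf_def
  by (intro prodinf_nonzero convergent_prod_qpoch_inf one_minus_mult_power_nonzero assms)

text \<open>The inverses converge because the limit \<open>qpoch_inf a q\<close> is nonzero.
  Coefficients with such denominators thus inherit summability from the powers of the base.\<close>

lemma inverse_qpoch_bounded:
  assumes "norm q < 1" "norm a < 1"
  obtains C where "\<And>n. norm (inverse (qpoch a q n)) \<le> C"
proof -
  have "(\<lambda>n. inverse (qpoch a q n)) \<longlonglongrightarrow> inverse (qpoch_inf a q)"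
    by (intro tendsto_inverse qpoch_tendsto_qpoch_inf qpoch_inf_nonzero assms)
  then have "Bseq (\<lambda>n. inverse (qpoch a q n))"
    by (intro convergent_imp_Bseq) (auto simp: convergent_def)
  then show ?thesis using that by (auto simp: Bseq_def)
qed

lemma one_plus_power_nonzero:
  fixes q :: complex
  assumes "norm q < 1"
  shows "1 + q ^ k \<noteq> 0"
proof
  assume *: "1 + q ^ k = 0"
  then have "q ^ k = - 1" by (simp add: eq_neg_iff_add_eq_0 add.commute)
  then have "norm (q ^ k) = 1" by simp
  then have "k = 0"
    using assms power_less_one_iff [of "norm q" k] by (auto simp: norm_power)
  with * show False by simp
qed

text \<open>Among the factors \<open>1 - q ^ i\<close> with \<open>i\<close> from 1 to
  \<open>2 * n\<close>, the odd exponents form the first product and the even ones the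
  second.\<close>

lemma qpoch_double: "qpoch q q (2 * n) = qpoch q (q\<^sup>2) n * qpoch (q\<^sup>2) (q\<^sup>2) n"
proof (induction n)
  case (Suc n)
  have "qpoch q q (2 * Suc n) = qpoch q q (2 * n) * (1 - q * (q\<^sup>2) ^ n) * (1 - q\<^sup>2 * (q\<^sup>2) ^ n)"
    by (simp add: qpoch_Suc power_mult power2_eq_square [symmetric] mult_ac)
       (simp add: power2_eq_square power_mult_distrib mult_ac)
  then show ?case unfolding Suc.IH by (simp add: qpoch_Suc mult_ac)
qed simp

text \<open>Euler's theorem on odd and distinct parts. Pairing \<open>1 + q ^ k\<close> with
  \<open>1 - q ^ k\<close> gives the product over even exponents, and so does removing the odd
  exponents from \<open>qpoch_inf q q\<close>; the common nonzero factor cancels.\<close>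

lemma euler_odd_distinct:
  assumes "norm q < 1"
  shows "qpoch_inf (- q) q * qpoch_inf q (q\<^sup>2) = 1"
proof -
  have q2: "norm (q\<^sup>2) < 1"
    using assms by (simp add: norm_power power_less_one_iff)
  note qpoch_double [of q]
  moreover have "(\<lambda>n. qpoch q q (2 * n)) \<longlonglongrightarrow> qpoch_inf q q"
    using qpoch_tendsto_qpoch_inf [OF assms]
    by (rule filterlim_compose) (auto intro: filterlim_subseq simp: strict_mono_def)
  ultimately have 1: "qpoch_inf q q = qpoch_inf q (q\<^sup>2) * qpoch_inf (q\<^sup>2) (q\<^sup>2)"
    using tendsto_mult [OF qpoch_tendsto_qpoch_inf [OF q2, of q] qpoch_tendsto_qpoch_inf [OF q2, of "q\<^sup>2"]]
    by (simp add: LIMSEQ_unique)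
  have "qpoch (- q) q n * qpoch q q n = qpoch (q\<^sup>2) (q\<^sup>2) n" for n
    unfolding qpoch_def prod.distrib [symmetric]
    by (intro prod.cong) (simp_all add: algebra_simps power2_eq_square power_mult_distrib)
  then have 2: "qpoch_inf (- q) q * qpoch_inf q q = qpoch_inf (q\<^sup>2) (q\<^sup>2)"
    using tendsto_mult [OF qpoch_tendsto_qpoch_inf [OF assms, of "-q"] qpoch_tendsto_qpoch_inf [OF assms, of q]]
      qpoch_tendsto_qpoch_inf [OF q2, of "q\<^sup>2"]
    by (simp add: LIMSEQ_unique)
  have "qpoch_inf (q\<^sup>2) (q\<^sup>2) \<noteq> 0"
    by (rule qpoch_inf_nonzero [OF q2 q2])
  then show ?thesis using 1 2 by (auto simp: algebra_simps)
qed

section \<open>Vanishing principle and limits along \<open>z * p ^ k\<close>\<close>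

text \<open>Iteration writes \<open>h 0\<close> as a product of the \<open>c k\<close> times
  \<open>h n\<close>. These products stay bounded because the powers of \<open>r\<close> are
  summable, while \<open>h n\<close> tends to 0. Applied to differences of solutions, this is the
  uniqueness statement for the functional equations.\<close>

lemma recursion_eq_0:
  fixes h c :: "nat \<Rightarrow> complex"
  assumes rec: "\<And>n. h n = c n * h (Suc n)"
    and c: "\<And>n. norm (c n) \<le> 1 + r ^ n" and r: "0 \<le> r" "r < 1" and lim: "h \<longlonglongrightarrow> 0"
  shows "h 0 = 0"
proof -
  have h: "h 0 = (\<Prod>k<n. c k) * h n" for n
  proof (induction n)
    case (Suc n)
    then show ?case using rec [of n] by simp
  qed simp
  have bound: "norm (\<Prod>k<n. c k) \<le> exp (\<Sum>k. r ^ k)" for n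
  proof -
    have "norm (\<Prod>k<n. c k) \<le> (\<Prod>k<n. 1 + r ^ k)"
      unfolding prod_norm [symmetric] by (intro prod_mono) (use c in auto)
    also have "\<dots> \<le> exp (\<Sum>k<n. r ^ k)"
      by (rule prod_le_exp_sum) (use r in auto)
    also have "\<dots> \<le> exp (\<Sum>k. r ^ k)"
      using r by (intro exp_le_cancel_iff [THEN iffD2] sum_le_suminf summable_geometric) auto
    finally show ?thesis .
  qed
  have lim': "(\<lambda>n. exp (\<Sum>k. r ^ k) * norm (h n)) \<longlonglongrightarrow> exp (\<Sum>k. r ^ k) * 0"
    using lim by (intro tendsto_mult_left) (simp add: tendsto_norm_zero_iff)
  have "norm (h 0) \<le> exp (\<Sum>k. r ^ k) * norm (h n)" for n
    unfolding h [of n] norm_mult by (intro mult_right_mono bound) auto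
  then have "norm (h 0) \<le> exp (\<Sum>k. r ^ k) * 0"
    by (intro tendsto_lowerbound [OF lim']) auto
  then show ?thesis by simp
qed

text \<open>The lower bound is \<open>n - 1\<close> rather than \<open>n\<close> so that the
  exponents \<open>n * (n - 1)\<close> and \<open>n choose 2\<close> qualify.\<close>

lemma summable_norm_power_mult:
  fixes p :: complex
  assumes p: "norm p < 1" and e: "\<And>n. n - 1 \<le> e n" and C: "\<And>n. norm (d n :: complex) \<le> C"
  shows "summable (\<lambda>n. norm (p ^ e n * d n))"
proof (rule summable_comparison_test')
  have "summable (\<lambda>n. C * norm p ^ (Suc n - 1))"
    using p by (simp add: summable_mult summable_geometric)
  then show "summable (\<lambda>n. C * norm p ^ (n - 1))"
    by (rule summable_Suc_iff [THEN iffD1])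
  fix n
  have "norm p ^ e n * norm (d n) \<le> norm p ^ (n - 1) * C"
    using p e C by (intro mult_mono power_decreasing) auto
  then show "norm (norm (p ^ e n * d n)) \<le> C * norm p ^ (n - 1)"
    by (simp add: norm_mult norm_power mult.commute)
qed

text \<open>Tannery's theorem with dominating terms \<open>norm (c j) * M\<close>: every term with
  \<open>j > 0\<close> contains a positive power of \<open>z * p ^ k\<close> and dies out, so only
  the constant coefficient survives.\<close>

lemma tendsto_power_series_scaled:
  fixes p z :: complex
  assumes p: "norm p < 1" and z: "norm z \<le> 1" and c: "summable (\<lambda>j. norm (c j))"
    and g: "\<And>j u. norm u \<le> 1 \<Longrightarrow> norm (g j u) \<le> M"
    and lim: "(\<lambda>k. g 0 (z * p ^ k)) \<longlonglongrightarrow> 1"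
  shows "(\<lambda>k. \<Sum>j. c j * (z * p ^ k) ^ j * g j (z * p ^ k)) \<longlonglongrightarrow> c 0"
proof -
  have small: "norm (z * p ^ k) \<le> 1" for k
    unfolding norm_mult norm_power using p z by (intro mult_le_one power_le_one) auto
  have zero: "(\<lambda>k. z * p ^ k) \<longlonglongrightarrow> 0"
    using p tendsto_mult_right_zero [OF LIMSEQ_power_zero [of p]] by simp
  have "((\<lambda>k. \<Sum>j. c j * (z * p ^ k) ^ j * g j (z * p ^ k))
      \<longlongrightarrow> (\<Sum>j. if j = 0 then c 0 else 0)) sequentially"
  proof (rule tannerys_theorem [THEN conjunct2, THEN conjunct2])
    show "summable (\<lambda>j. norm (c j) * M)"
      using c by (rule summable_mult2)
    show "\<forall>\<^sub>F (j, k) in at_top \<times>\<^sub>F sequentially.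
        norm (c j * (z * p ^ k) ^ j * g j (z * p ^ k)) \<le> norm (c j) * M"
    proof (rule always_eventually, safe)
      fix j k
      have "norm (c j) * norm (z * p ^ k) ^ j * norm (g j (z * p ^ k)) \<le> norm (c j) * 1 * M"
        using small g by (intro mult_mono power_le_one) auto
      then show "norm (c j * (z * p ^ k) ^ j * g j (z * p ^ k)) \<le> norm (c j) * M"
        by (simp add: norm_mult norm_power)
    qed
    fix j
    show "(\<lambda>k. c j * (z * p ^ k) ^ j * g j (z * p ^ k)) \<longlonglongrightarrow> (if j = 0 then c 0 else 0)"
    proof (cases "j = 0")
      case True
      then show ?thesis using tendsto_mult_left [OF lim, of "c 0"] by simp
    next
      case False
      have "(\<lambda>k. c j * (z * p ^ k) ^ j) \<longlonglongrightarrow> c j * 0 ^ j"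
        by (intro tendsto_intros zero)
      then have "(\<lambda>k. c j * (z * p ^ k) ^ j) \<longlonglongrightarrow> 0"
        using False by (simp add: power_0_left)
      then have "(\<lambda>k. c j * (z * p ^ k) ^ j * g j (z * p ^ k)) \<longlonglongrightarrow> 0"
        by (rule lim_null_mult_right_bounded [where B = M]) (use g small in auto)
      then show ?thesis
        using False by simp
    qed
  qed simp
  then show ?thesis
    using suminf_finite [of "{0}" "\<lambda>j. if j = 0 then c 0 else 0"] by simp
qed

section \<open>A functional equation for the mock theta function\<close>

lemma summable_power_series_mult:
  fixes c :: "nat \<Rightarrow> complex"
  assumes "summable (\<lambda>j. norm (c j))" "norm z \<le> 1" "\<And>j. norm (g j) \<le> M"
  shows "summable (\<lambda>j. c j * z ^ j * g j)"
proof (rule summable_comparison_test')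
  show "summable (\<lambda>j. norm (c j) * M)"
    using assms(1) by (rule summable_mult2)
  fix j
  have "norm (c j) * norm z ^ j * norm (g j) \<le> norm (c j) * 1 * M"
    using assms by (intro mult_mono power_le_one) auto
  then show "norm (c j * z ^ j * g j) \<le> norm (c j) * M"
    by (simp add: norm_mult norm_power)
qed

lemma norm_mult_power_le_1:
  fixes p z :: complex
  assumes "norm p < 1" "norm z \<le> 1"
  shows "norm (z * p ^ k) \<le> 1"
  unfolding norm_mult norm_power using assms by (intro mult_le_one power_le_one) auto

text \<open>This is Cauchy's expansion of \<open>1 / qpoch_inf z p\<close> multiplied through by
  \<open>qpoch_inf z p\<close>, which keeps it meaningful where that product vanishes, as at
  \<open>z = 1\<close>. First \<open>W\<close> is shown invariant under \<open>u\<close> to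
  \<open>u * p\<close>, then its constant value is read off from the limit.\<close>

lemma durfee_identity:
  fixes p z :: complex
  assumes p: "norm p < 1" and z: "norm z \<le> 1"
  shows "(\<lambda>j. p ^ (j * (j - 1)) * inverse (qpoch p p j) * z ^ j * qpoch_inf (z * p ^ j) p) sums 1"
proof -
  define c where "c = (\<lambda>j. p ^ (j * (j - 1)) * inverse (qpoch p p j))"
  define t where "t = (\<lambda>u j. c j * u ^ j * qpoch_inf (u * p ^ j) p)"
  define W where "W = (\<lambda>u. suminf (t u))"
  have small: "norm (u * p ^ k) \<le> 1" if "norm u \<le> 1" for u k
    using norm_mult_power_le_1 [OF p that] .
  have small1: "norm (u * p) \<le> 1" if "norm u \<le> 1" for u
    using small [OF that, of 1] by simp
  obtain C where C: "\<And>n. norm (inverse (qpoch p p n)) \<le> C"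
    using inverse_qpoch_bounded [OF p p] by blast
  have c: "summable (\<lambda>j. norm (c j))"
    unfolding c_def
  proof (rule summable_norm_power_mult [OF p _ C])
    fix n :: nat
    show "n - 1 \<le> n * (n - 1)" by (cases n) auto
  qed
  have E: "norm (qpoch_inf (u * p ^ k) p) \<le> exp (1 / (1 - norm p))" if "norm u \<le> 1" for u k
    by (intro norm_qpoch_inf_le p small that)
  have W: "t u sums W u" if "norm u \<le> 1" for u
    unfolding W_def t_def using that E
    by (intro summable_sums summable_power_series_mult [OF c]) auto
  have c_Suc: "c (Suc j) * (1 - p ^ Suc j) = c j * p ^ (2 * j)" for j
  proof -
    have "1 - p * p ^ j \<noteq> 0" by (rule one_minus_mult_power_nonzero [OF p p])
    moreover have "qpoch p p j \<noteq> 0" by (rule qpoch_nonzero [OF p p])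
    moreover have "Suc j * j = j * (j - 1) + 2 * j"
      by (cases j) simp_all
    then have "p ^ (Suc j * j) = p ^ (j * (j - 1)) * p ^ (2 * j)"
      by (simp only: power_add)
    ultimately show ?thesis
      by (simp add: c_def qpoch_Suc field_simps)
  qed
  have E_rec: "qpoch_inf a p = (1 - a) * qpoch_inf (a * p) p" for a
    by (rule qpoch_inf_rec [OF p])
  have step: "W u - W (u * p) = - u * (W (u * p) - W (u * p * p))" if u: "norm u \<le> 1" for u
  proof -
    \<comment> \<open>By \<open>E_rec\<close>, \<open>t u j - t (u * p) j\<close> is a multiple of
      \<open>1 - u * p ^ j - p ^ j\<close>. Adding \<open>g\<close> removes the middle term and
      leaves \<open>f\<close>, whose factor \<open>1 - p ^ j\<close> kills the term at 0 and permits
      the index shift through \<open>c_Suc\<close>.\<close>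
    define g where "g = (\<lambda>j. c j * u ^ Suc j * p ^ j * qpoch_inf (u * p ^ Suc j) p)"
    define f where "f = (\<lambda>j. c j * (1 - p ^ j) * u ^ j * qpoch_inf (u * p ^ Suc j) p)"
    have g: "g sums suminf g"
    proof (intro summable_sums)
      have bound: "norm (u * p ^ j * qpoch_inf (u * p ^ Suc j) p) \<le> 1 * exp (1 / (1 - norm p))" for j
        unfolding norm_mult [of "u * p ^ j"] using u by (intro mult_mono small E) auto
      have "g = (\<lambda>j. c j * u ^ j * (u * p ^ j * qpoch_inf (u * p ^ Suc j) p))"
        by (simp add: g_def mult_ac)
      then show "summable g"
        by (simp only: summable_power_series_mult [OF c u bound])
    qed
    have "(\<lambda>j. t u j - t (u * p) j + g j) sums (W u - W (u * p) + suminf g)"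
      by (intro sums_add sums_diff W g u small1)
    also have "(\<lambda>j. t u j - t (u * p) j + g j) = f"
      unfolding t_def f_def g_def
      by (subst E_rec [of "u * p ^ j" for j]) (simp add: algebra_simps power_mult_distrib)
    finally have "(\<lambda>j. f (Suc j)) sums (W u - W (u * p) + suminf g)"
      by (subst sums_Suc_iff) (simp add: f_def)
    then have "(\<lambda>j. f (Suc j) - g j) sums (W u - W (u * p) + suminf g - suminf g)"
      by (intro sums_diff g)
    moreover have "f (Suc j) - g j = - u * (t (u * p) j - t (u * p * p) j)" for j
    proof -
      have "f (Suc j) = c j * p ^ (2 * j) * u ^ Suc j * qpoch_inf (u * p ^ Suc (Suc j)) p"
        unfolding f_def c_Suc ..
      moreover have "qpoch_inf (u * p ^ Suc j) p
          = (1 - u * p ^ Suc j) * qpoch_inf (u * p ^ Suc (Suc j)) p"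
        by (subst E_rec) (simp add: mult_ac)
      ultimately show ?thesis
        by (simp add: g_def t_def algebra_simps power_mult_distrib power_mult power2_eq_square
            del: power_Suc) (simp add: algebra_simps power_mult_distrib)
    qed
    moreover have "(\<lambda>j. - u * (t (u * p) j - t (u * p * p) j))
        sums (- u * (W (u * p) - W (u * p * p)))"
      by (intro sums_mult sums_diff W u small1)
    ultimately show ?thesis
      by (simp add: sums_unique2)
  qed
  have lim: "(\<lambda>k. W (u * p ^ k)) \<longlonglongrightarrow> 1" if u: "norm u \<le> 1" for u
  proof -
    have "(\<lambda>k. W (u * p ^ k)) \<longlonglongrightarrow> c 0"
      unfolding W_def t_def using p u c
    proof (rule tendsto_power_series_scaled)
      show "norm (qpoch_inf (v * p ^ j) p) \<le> exp (1 / (1 - norm p))" if "norm v \<le> 1" for v j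
        by (rule E [OF that])
      show "(\<lambda>k. qpoch_inf (u * p ^ k * p ^ 0) p) \<longlonglongrightarrow> 1"
        using qpoch_inf_scaled_tendsto_1 [OF p] by simp
    qed
    then show ?thesis by (simp add: c_def)
  qed
  have invariant: "W u = W (u * p)" if u: "norm u \<le> 1" for u
  proof -
    \<comment> \<open>By \<open>step\<close>, consecutive differences satisfy a homogeneous
      recursion with factors \<open>- (u * p ^ n)\<close>.\<close>
    define h where "h = (\<lambda>n. W (u * p ^ n) - W (u * p ^ Suc n))"
    have "h 0 = 0"
    proof (rule recursion_eq_0)
      show "h n = - (u * p ^ n) * h (Suc n)" for n
        using step [OF small [OF u, of n]] by (simp add: h_def mult_ac)
      show "norm (- (u * p ^ n)) \<le> 1 + norm p ^ n" for n
        using small [OF u, of n] by (simp add: add_increasing2)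
      have "h \<longlonglongrightarrow> 1 - 1"
        unfolding h_def by (intro tendsto_diff lim u LIMSEQ_Suc)
      then show "h \<longlonglongrightarrow> 0" by simp
    qed (use p in auto)
    then show ?thesis by (simp add: h_def)
  qed
  have "W (z * p ^ n) = W z" for n
    by (induction n) (use invariant [OF small [OF z]] in \<open>simp_all add: mult_ac\<close>)
  then have "W z = 1"
    using lim [OF z] by (simp add: LIMSEQ_const_iff)
  then show ?thesis
    using W [OF z] by (simp add: t_def c_def)
qed

text \<open>The difference \<open>F = B - 2 * A\<close> satisfies the homogeneous equation
  \<open>F u = - (1 + u) * F (u * p)\<close> and tends to 0 along \<open>z * p ^ n\<close>, so
  \<open>recursion_eq_0\<close> applies.\<close>

lemma mock_theta_transformation:
  fixes p z :: complex
  assumes p: "norm p < 1" and z: "norm z \<le> 1"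
  defines "a \<equiv> \<lambda>j. p ^ (j * j) * inverse (qpoch p p j * (1 + p ^ j)) * z ^ j * qpoch_inf (z * p ^ j) p"
    and "b \<equiv> \<lambda>n. (- 1) ^ n * p ^ (n choose 2) * inverse (qpoch (- p) p n) * z ^ n"
  shows "suminf b = 2 * suminf a"
proof -
  define c where "c = (\<lambda>j. p ^ (j * j) * inverse (qpoch p p j * (1 + p ^ j)))"
  define d where "d = (\<lambda>n. p ^ (n choose 2) * ((- 1) ^ n * inverse (qpoch (- p) p n)))"
  define s where "s = (\<lambda>u j. c j * u ^ j * qpoch_inf (u * p ^ j) p)"
  \<comment> \<open>The factor 1 stands in for \<open>g j\<close>, so that the general lemmas on
    such series apply.\<close>
  define t where "t = (\<lambda>u j. d j * u ^ j * 1)"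
  define A where "A = (\<lambda>u. suminf (s u))"
  define B where "B = (\<lambda>u. suminf (t u))"
  have small: "norm (u * p ^ k) \<le> 1" if "norm u \<le> 1" for u k
    using norm_mult_power_le_1 [OF p that] .
  have small1: "norm (u * p) \<le> 1" if "norm u \<le> 1" for u
    using small [OF that, of 1] by simp
  have "(\<lambda>j. inverse (qpoch p p j * (1 + p ^ j))) \<longlonglongrightarrow> inverse (qpoch_inf p p * (1 + 0))"
    using p by (intro tendsto_intros qpoch_tendsto_qpoch_inf LIMSEQ_power_zero)
      (auto simp: qpoch_inf_nonzero)
  then have "Bseq (\<lambda>j. inverse (qpoch p p j * (1 + p ^ j)))"
    by (intro convergent_imp_Bseq) (auto simp: convergent_def)
  then obtain C where C: "\<And>n. norm (inverse (qpoch p p n * (1 + p ^ n))) \<le> C"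
    by (auto simp: Bseq_def)
  have c: "summable (\<lambda>j. norm (c j))"
    unfolding c_def
  proof (rule summable_norm_power_mult [OF p _ C])
    fix n :: nat
    show "n - 1 \<le> n * n" by (cases n) auto
  qed
  obtain D where D: "\<And>n. norm (inverse (qpoch (- p) p n)) \<le> D"
    using inverse_qpoch_bounded [OF p, of "- p"] p by auto
  have d: "summable (\<lambda>j. norm (d j))"
    unfolding d_def using p
  proof (rule summable_norm_power_mult)
    fix n :: nat
    show "n - 1 \<le> (n choose 2)"
      by (induction n) (auto simp: numeral_2_eq_2)
    show "norm ((- 1) ^ n * inverse (qpoch (- p) p n)) \<le> D"
      using D [of n] by (simp add: norm_mult norm_power)
  qed
  have E: "norm (qpoch_inf (u * p ^ k) p) \<le> exp (1 / (1 - norm p))" if "norm u \<le> 1" for u k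
    by (intro norm_qpoch_inf_le p small that)
  have A: "s u sums A u" if "norm u \<le> 1" for u
    unfolding A_def s_def using that E
    by (intro summable_sums summable_power_series_mult [OF c]) auto
  have B: "t u sums B u" if "norm u \<le> 1" for u
    unfolding B_def t_def using that
    by (intro summable_sums summable_power_series_mult [OF d, where M = 1]) auto
  have A_rec: "A u + (1 + u) * A (u * p) = 1" if u: "norm u \<le> 1" for u
  proof (rule sums_unique2)
    show "(\<lambda>j. s u j + (1 + u) * s (u * p) j) sums (A u + (1 + u) * A (u * p))"
      by (intro sums_add sums_mult A u small1)
    \<comment> \<open>The coefficient becomes
      \<open>(1 - u * p ^ j) + (1 + u) * p ^ j = 1 + p ^ j\<close>, which cancels the denominator
      and leaves the Durfee series at \<open>u * p\<close>.\<close>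
    have "s u j + (1 + u) * s (u * p) j
        = p ^ (j * (j - 1)) * inverse (qpoch p p j) * (u * p) ^ j * qpoch_inf (u * p * p ^ j) p" for j
    proof -
      have *: "qpoch_inf (u * p ^ j) p = (1 - u * p ^ j) * qpoch_inf (u * p * p ^ j) p"
        by (subst qpoch_inf_rec [OF p]) (simp add: mult_ac)
      have "s u j + (1 + u) * s (u * p) j
          = c j * (1 + p ^ j) * u ^ j * qpoch_inf (u * p * p ^ j) p"
        unfolding s_def power_mult_distrib * by (simp add: algebra_simps)
      also have "c j * (1 + p ^ j) = p ^ (j * j) * inverse (qpoch p p j)"
        using one_plus_power_nonzero [OF p, of j] by (simp add: c_def)
      also have "p ^ (j * j) = p ^ (j * (j - 1)) * p ^ j"
        by (cases j) (simp_all add: power_add mult_ac)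
      finally show ?thesis by (simp add: power_mult_distrib mult_ac)
    qed
    then show "(\<lambda>j. s u j + (1 + u) * s (u * p) j) sums 1"
      using durfee_identity [OF p small1 [OF u]] by simp
  qed
  have B_rec: "B u + (1 + u) * B (u * p) = 2" if u: "norm u \<le> 1" for u
  proof -
    define f where "f = (\<lambda>j. t u j + t (u * p) j)"
    have "f sums (B u + B (u * p))"
      unfolding f_def by (intro sums_add B u small1)
    \<comment> \<open>Both constant terms are 1; this is the right-hand side of the equation. The
      remaining terms, shifted by one, reproduce the series at \<open>u * p\<close> up to the factor
      \<open>- u\<close>.\<close>
    moreover have "f 0 = 2"
      by (simp add: f_def t_def d_def numeral_2_eq_2)
    ultimately have "(\<lambda>j. f (Suc j)) sums (B u + B (u * p) - 2)"
      by (subst sums_Suc_iff) simp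
    moreover have "f (Suc j) = - u * t (u * p) j" for j
    proof -
      have "1 + p * p ^ j \<noteq> 0" using one_plus_power_nonzero [OF p, of "Suc j"] by simp
      moreover have "d (Suc j) = - d j * p ^ j * inverse (1 + p * p ^ j)"
        by (simp add: d_def qpoch_Suc numeral_2_eq_2 power_add mult_ac)
      ultimately have "d (Suc j) * (1 + p ^ Suc j) = - d j * p ^ j"
        by simp
      moreover have "f (Suc j) = d (Suc j) * (1 + p ^ Suc j) * u ^ Suc j"
        by (simp add: f_def t_def algebra_simps power_mult_distrib)
      ultimately show ?thesis
        by (simp add: t_def power_mult_distrib)
    qed
    ultimately have "(\<lambda>j. - u * t (u * p) j) sums (B u + B (u * p) - 2)"
      by simp
    moreover have "(\<lambda>j. - u * t (u * p) j) sums (- u * B (u * p))"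
      by (intro sums_mult B u small1)
    ultimately have "B u + B (u * p) - 2 = - u * B (u * p)"
      by (rule sums_unique2)
    then show ?thesis by (simp add: algebra_simps)
  qed
  have "(\<lambda>k. A (z * p ^ k)) \<longlonglongrightarrow> c 0"
    unfolding A_def s_def using p z c
  proof (rule tendsto_power_series_scaled)
    show "norm (qpoch_inf (v * p ^ j) p) \<le> exp (1 / (1 - norm p))" if "norm v \<le> 1" for v j
      by (rule E [OF that])
    show "(\<lambda>k. qpoch_inf (z * p ^ k * p ^ 0) p) \<longlonglongrightarrow> 1"
      using qpoch_inf_scaled_tendsto_1 [OF p] by simp
  qed
  moreover have "(\<lambda>k. B (z * p ^ k)) \<longlonglongrightarrow> d 0"
    unfolding B_def t_def using p z d
    by (rule tendsto_power_series_scaled [where M = 1]) auto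
  ultimately have lim: "(\<lambda>k. B (z * p ^ k) - 2 * A (z * p ^ k)) \<longlonglongrightarrow> d 0 - 2 * c 0"
    by (intro tendsto_intros)
  define h where "h = (\<lambda>k. B (z * p ^ k) - 2 * A (z * p ^ k))"
  have "h 0 = 0"
  proof (rule recursion_eq_0)
    show "h n = - (1 + z * p ^ n) * h (Suc n)" for n
    proof -
      have eqs: "A (z * p ^ n) = 1 - (1 + z * p ^ n) * A (z * p ^ Suc n)"
        "B (z * p ^ n) = 2 - (1 + z * p ^ n) * B (z * p ^ Suc n)"
        using A_rec [OF small [OF z, of n]] B_rec [OF small [OF z, of n]]
        by (simp_all add: eq_diff_eq mult_ac)
      show ?thesis
        unfolding h_def eqs by (simp add: algebra_simps)
    qed
    show "norm (- (1 + z * p ^ n)) \<le> 1 + norm p ^ n" for n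
    proof -
      have "norm (1 + z * p ^ n) \<le> norm (1::complex) + norm z * norm p ^ n"
        using norm_triangle_ineq [of 1 "z * p ^ n"] by (simp add: norm_mult norm_power)
      also have "\<dots> \<le> 1 + 1 * norm p ^ n"
        using z by (intro add_mono mult_right_mono) auto
      finally show ?thesis by (simp add: norm_minus_cancel del: minus_add_distrib)
    qed
    \<comment> \<open>Here \<open>d 0 = 1\<close>, and \<open>c 0 = 1 / 2\<close> because
      \<open>1 + p ^ 0 = 2\<close>.\<close>
    show "h \<longlonglongrightarrow> 0"
      using lim by (simp add: h_def c_def d_def numeral_2_eq_2)
  qed (use p in auto)
  moreover have "s z = a" "t z = b"
    by (simp_all add: s_def t_def a_def b_def c_def d_def mult_ac)
  ultimately show ?thesis
    using A [OF z] by (auto simp: h_def A_def B_def sums_iff)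
qed

section \<open>Distinct parts with odd smallest part\<close>

definition distinct_parts :: "nat set set" where
  "distinct_parts = {S. finite S \<and> 0 \<notin> S}"

text \<open>Any finite partial sum of norms is part of the expansion of a finite product of factors
  \<open>1 + norm q ^ k\<close>. Absolute summability then allows the sets to be split and regrouped
  freely.\<close>

lemma summable_distinct_parts:
  fixes q :: complex
  assumes "norm q < 1"
  shows "(\<lambda>S. q ^ \<Sum>S) summable_on distinct_parts"
proof (rule abs_summable_summable, rule nonneg_bdd_above_summable_on)
  show "bdd_above (sum (\<lambda>S. norm (q ^ \<Sum>S)) ` {F. F \<subseteq> distinct_parts \<and> finite F})"
  proof (rule bdd_aboveI2)
    fix F assume F: "F \<in> {F. F \<subseteq> distinct_parts \<and> finite F}"
    define N where "N = Max (insert 0 (\<Union>F))"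
    have fin: "finite (\<Union>F)" using F by (auto simp: distinct_parts_def)
    have "F \<subseteq> Pow {1..N}"
    proof safe
      fix S n assume Sn: "S \<in> F" "n \<in> S"
      then have "n \<noteq> 0" using F by (auto simp: distinct_parts_def intro: gr0I)
      moreover have "n \<le> N"
        unfolding N_def using Sn fin by (intro Max_ge) auto
      ultimately show "n \<in> {1..N}" by simp
    qed
    then have "(\<Sum>S\<in>F. norm (q ^ \<Sum>S)) \<le> (\<Sum>S\<in>Pow {1..N}. norm q ^ \<Sum>S)"
      by (simp add: norm_power sum_mono2)
    also have "\<dots> = (\<Prod>k\<in>{1..N}. norm q ^ k + 1)"
      by (subst prod_add) (simp_all add: power_sum)
    also have "\<dots> \<le> exp (\<Sum>k\<in>{1..N}. norm q ^ k)"
      using prod_le_exp_sum [of "{1..N}" "\<lambda>k. norm q ^ k"] by (simp add: add.commute)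
    also have "\<dots> \<le> exp (\<Sum>k. norm q ^ k)"
      using assms by (intro exp_le_cancel_iff [THEN iffD2] sum_le_suminf summable_geometric) auto
    finally show "(\<Sum>S\<in>F. norm (q ^ \<Sum>S)) \<le> exp (\<Sum>k. norm q ^ k)" .
  qed
qed auto

text \<open>Subtracting 1 from every part inverts the shift, and keeps the parts positive exactly
  when 1 is not a part.\<close>

lemma Suc_image_distinct_parts:
  "(`) Suc ` distinct_parts = {S \<in> distinct_parts. 1 \<notin> S}"
proof safe
  fix S assume S: "S \<in> distinct_parts" "1 \<notin> S"
  have "Suc (n - 1) = n" if "n \<in> S" for n
    using S that by (cases n) (auto simp: distinct_parts_def)
  then have "Suc ` (\<lambda>n. n - 1) ` S = S"
    by (simp add: image_image)
  moreover have "(\<lambda>n. n - 1) ` S \<in> distinct_parts"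
    using S by (auto simp: distinct_parts_def) (metis One_nat_def diff_is_0_eq le_0_eq le_Suc_eq)
  ultimately show "S \<in> (`) Suc ` distinct_parts" by (metis imageI)
qed (auto simp: distinct_parts_def)

lemma sum_Suc_image:
  assumes "finite S"
  shows "\<Sum>(Suc ` S) = \<Sum>S + card S"
  using assms by (simp add: sum.reindex sum_Suc)

lemma has_sum_Suc_image:
  fixes q :: complex
  assumes "A \<subseteq> {S \<in> distinct_parts. card S = m}" "((\<lambda>S. q ^ \<Sum>S) has_sum s) A"
  shows "((\<lambda>S. q ^ \<Sum>S) has_sum (q ^ m * s)) ((`) Suc ` A)"
proof (subst has_sum_reindex)
  show "inj_on ((`) Suc) A" by (auto intro: inj_onI simp: inj_image_eq_iff)
  have "((\<lambda>S. q ^ m * q ^ \<Sum>S) has_sum (q ^ m * s)) A"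
    by (intro has_sum_cmult_right assms)
  also have "?this \<longleftrightarrow> (((\<lambda>S. q ^ \<Sum>S) \<circ> (`) Suc) has_sum (q ^ m * s)) A"
    using assms(1) by (intro has_sum_cong) (auto simp: distinct_parts_def sum_Suc_image power_add)
  finally show "(((\<lambda>S. q ^ \<Sum>S) \<circ> (`) Suc) has_sum (q ^ m * s)) A" .
qed

text \<open>Split by whether 1 is a part. Sets without 1 are shifts of sets of the same size; sets
  with 1 arise by inserting 1 into a shifted set with one part fewer. This gives a linear equation
  for the new sum \<open>t\<close>.\<close>

lemma distinct_parts_gf:
  fixes q :: complex
  assumes "norm q < 1"
  shows "((\<lambda>S. q ^ \<Sum>S) has_sum (q ^ (Suc m choose 2) / qpoch q q m))
           {S \<in> distinct_parts. card S = m}"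
proof (induction m)
  case 0
  have "{S \<in> distinct_parts. card S = 0} = {{}}" by (auto simp: distinct_parts_def)
  then show ?case by (simp add: has_sum_finite_iff numeral_2_eq_2)
next
  case (Suc m)
  define w where "w = (\<lambda>S :: nat set. q ^ \<Sum>S)"
  let ?D = "\<lambda>m. {S \<in> distinct_parts. card S = m}"
  define s where "s = q ^ (Suc m choose 2) / qpoch q q m"
  define t where "t = infsum w (?D (Suc m))"
  have s: "(w has_sum s) (?D m)"
    using Suc by (simp add: w_def s_def)
  have t: "(w has_sum t) (?D (Suc m))"
    unfolding t_def w_def
    by (intro has_sum_infsum summable_on_subset [OF summable_distinct_parts [OF assms]]) auto
  have card_Suc: "card (Suc ` S) = card S" for S :: "nat set"
    by (simp add: card_image)
  have no1: "(`) Suc ` ?D k = {S \<in> ?D k. 1 \<notin> S}" for k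
  proof -
    have "(`) Suc ` ?D k = {S \<in> (`) Suc ` distinct_parts. card S = k}"
      by (auto simp: card_Suc)
    then show ?thesis unfolding Suc_image_distinct_parts by auto
  qed
  have "insert 1 ` {S \<in> ?D m. 1 \<notin> S} = {S \<in> ?D (Suc m). 1 \<in> S}"
  proof safe
    fix S assume S: "S \<in> distinct_parts" "card S = Suc m" "1 \<in> S"
    then have "S = insert 1 (S - {1})" "S - {1} \<in> {S \<in> ?D m. 1 \<notin> S}"
      by (auto simp: distinct_parts_def)
    then show "S \<in> insert 1 ` {S \<in> ?D m. 1 \<notin> S}" by blast
  qed (auto simp: distinct_parts_def)
  moreover have "inj_on (insert 1) {S \<in> ?D m. 1 \<notin> S}"
    by (auto intro!: inj_onI dest: insert_ident [THEN iffD1, rotated 2])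
  moreover have "((w \<circ> insert 1) has_sum (q * (q ^ m * s))) {S \<in> ?D m. 1 \<notin> S}"
  proof -
    have "((\<lambda>S. q * w S) has_sum (q * (q ^ m * s))) {S \<in> ?D m. 1 \<notin> S}"
      unfolding no1 [symmetric] w_def
      by (intro has_sum_cmult_right has_sum_Suc_image s [unfolded w_def]) auto
    also have "?this \<longleftrightarrow> ?thesis"
      by (intro has_sum_cong) (auto simp: w_def distinct_parts_def)
    finally show ?thesis .
  qed
  ultimately have "(w has_sum (q * (q ^ m * s))) {S \<in> ?D (Suc m). 1 \<in> S}"
    using has_sum_reindex [of "insert 1" "{S \<in> ?D m. 1 \<notin> S}" w] by simp
  moreover have "(w has_sum (q ^ Suc m * t)) {S \<in> ?D (Suc m). 1 \<notin> S}"
    unfolding no1 [symmetric] w_def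
    by (rule has_sum_Suc_image) (use t in \<open>auto simp: w_def\<close>)
  ultimately have "(w has_sum (q * (q ^ m * s) + q ^ Suc m * t))
      ({S \<in> ?D (Suc m). 1 \<in> S} \<union> {S \<in> ?D (Suc m). 1 \<notin> S})"
    by (intro has_sum_Un_disjoint) auto
  also have "{S \<in> ?D (Suc m). 1 \<in> S} \<union> {S \<in> ?D (Suc m). 1 \<notin> S} = ?D (Suc m)" by auto
  \<comment> \<open>The unknown occurs on both sides; its existence as a sum was secured beforehand
    by \<open>summable_distinct_parts\<close>.\<close>
  finally have "t = q * (q ^ m * s) + q ^ Suc m * t"
    using t by (intro has_sum_unique)
  then have "t * (1 - q * q ^ m) = q ^ Suc m * s"
    by (simp add: algebra_simps)
  moreover have "1 - q * q ^ m \<noteq> 0"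
    by (rule one_minus_mult_power_nonzero [OF assms assms])
  ultimately have "t = q ^ Suc m * s / (1 - q * q ^ m)"
    by (simp add: field_simps)
  also have "\<dots> = q ^ (Suc (Suc m) choose 2) / qpoch q q (Suc m)"
    by (simp add: s_def qpoch_Suc numeral_2_eq_2 power_add mult_ac)
  finally show ?case using t by (simp add: w_def)
qed

text \<open>Adding 1 to every part swaps the parities of the smallest part.\<close>

lemma distinct_parts_odd_Min_gf:
  fixes q :: complex
  assumes "norm q < 1" "m > 0"
  shows "((\<lambda>S. q ^ \<Sum>S) has_sum (q ^ (Suc m choose 2) / (qpoch q q m * (1 + q ^ m))))
           {S \<in> distinct_parts. card S = m \<and> odd (Min S)}"
proof -
  define w where "w = (\<lambda>S :: nat set. q ^ \<Sum>S)"
  define A where "A = {S \<in> distinct_parts. card S = m \<and> odd (Min S)}"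
  define s where "s = infsum w A"
  have s: "(w has_sum s) A"
    unfolding s_def w_def
    by (intro has_sum_infsum summable_on_subset [OF summable_distinct_parts [OF assms(1)]])
       (auto simp: A_def)
  \<comment> \<open>Since \<open>m > 0\<close>, \<open>Min\<close> is only taken of nonempty
    sets.\<close>
  have nonempty: "finite S" "S \<noteq> {}" if "S \<in> distinct_parts" "card S = m" for S
    using that assms(2) by (auto simp: distinct_parts_def)
  have Min_Suc: "Min (Suc ` S) = Suc (Min S)" if "finite S" "S \<noteq> {}" for S
    using that mono_Min_commute [of Suc S] by (simp add: mono_def)
  have "(w has_sum (q ^ m * s)) ((`) Suc ` A)"
    unfolding w_def by (rule has_sum_Suc_image) (use s in \<open>auto simp: w_def A_def\<close>)
  moreover have "even (Min S)" if "S \<in> (`) Suc ` A" for S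
  proof -
    from that obtain T where T: "S = Suc ` T" "T \<in> A" by blast
    then have "T \<in> distinct_parts" "card T = m" "odd (Min T)" by (simp_all add: A_def)
    with T(1) nonempty [of T] show ?thesis by (simp add: Min_Suc)
  qed
  then have "A \<inter> (`) Suc ` A = {}"
    unfolding A_def by blast
  ultimately have "(w has_sum (s + q ^ m * s)) (A \<union> (`) Suc ` A)"
    by (intro has_sum_Un_disjoint s)
  \<comment> \<open>An even minimum excludes the part 1, so such a set is a shift, and the set it is
    shifted from has odd minimum.\<close>
  also have "A \<union> (`) Suc ` A = {S \<in> distinct_parts. card S = m}"
  proof safe
    fix S assume S: "S \<in> distinct_parts" "m = card S" "S \<notin> (`) Suc ` A"
    show "S \<in> A"
    proof (rule ccontr)
      assume "S \<notin> A"
      with S have even: "even (Min S)" by (auto simp: A_def)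
      have "1 \<notin> S"
      proof
        assume "1 \<in> S"
        then have "Min S \<le> 1" "Min S \<in> S" using S nonempty [of S] by (auto intro: Min_le Min_in)
        with even S(1) show False by (cases "Min S") (auto simp: distinct_parts_def)
      qed
      then obtain T where T: "T \<in> distinct_parts" "S = Suc ` T"
        using S Suc_image_distinct_parts by blast
      moreover have "card T = m" using T S by (simp add: card_image)
      ultimately have "T \<in> A" using even nonempty [of T] by (auto simp: A_def Min_Suc)
      with S T show False by blast
    qed
  next
    fix T assume "T \<in> A"
    then have T: "T \<in> distinct_parts" "card T = m" by (auto simp: A_def)
    then show "Suc ` T \<in> distinct_parts"
      using Suc_image_distinct_parts by blast
    show "card (Suc ` T) = m" using T by (simp add: card_image)
  qed (auto simp: A_def)
  finally have "s + q ^ m * s = q ^ (Suc m choose 2) / qpoch q q m"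
    unfolding w_def using distinct_parts_gf [OF assms(1)] by (rule has_sum_unique)
  then have "s * (1 + q ^ m) = q ^ (Suc m choose 2) / qpoch q q m"
    by (simp add: algebra_simps)
  then have "s = q ^ (Suc m choose 2) / (qpoch q q m * (1 + q ^ m))"
    using one_plus_power_nonzero [OF assms(1), of m]
    by (simp add: nonzero_eq_divide_eq flip: divide_divide_eq_left)
  with s show ?thesis by (simp add: w_def A_def)
qed

section \<open>From sets of parts to the counting function\<close>

text \<open>Summation by fibres of \<open>g\<close>: the map \<open>x\<close> to
  \<open>(g x, x)\<close> turns \<open>T\<close> into a dependent sum over \<open>A\<close>. It
  serves to slice one family of sets in two ways.\<close>

lemma has_sum_fibres:
  fixes f :: "'a \<Rightarrow> 'b :: {topological_comm_monoid_add, t3_space}"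
  assumes "(f has_sum s) T" "g ` T \<subseteq> A" "\<And>a. a \<in> A \<Longrightarrow> (f has_sum h a) {x \<in> T. g x = a}"
  shows "(h has_sum s) A"
proof (rule has_sum_SigmaD)
  have "((\<lambda>(a, x). f x) has_sum s) (Sigma A (\<lambda>a. {x \<in> T. g x = a})) \<longleftrightarrow> (f has_sum s) T"
    by (rule has_sum_reindex_bij_witness [of _ "\<lambda>x. (g x, x)" snd]) (use assms(2) in auto)
  with assms(1) show "((\<lambda>(a, x). f x) has_sum s) (Sigma A (\<lambda>a. {x \<in> T. g x = a}))"
    by simp
  show "((\<lambda>x. case (a, x) of (a, x) \<Rightarrow> f x) has_sum h a) {x \<in> T. g x = a}" if "a \<in> A" for a
    using assms(3) [OF that] by simp
qed

text \<open>The empty set has an even number of elements but no minimum, hence its explicit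
  exclusion.\<close>

definition even_odd_Min_parts :: "nat set set" where
  "even_odd_Min_parts = {S \<in> distinct_parts. S \<noteq> {} \<and> even (card S) \<and> odd (Min S)}"

lemma p_do_e_eq_card:
  assumes "n > 0"
  shows "p_do_e n = card {S \<in> even_odd_Min_parts. \<Sum>S = n}"
    and "finite {S \<in> even_odd_Min_parts. \<Sum>S = n}"
proof -
  let ?M = "{M \<in> partitions n.
     (\<forall>k\<in>#M. count M k = 1) \<and> even (size M) \<and> odd (Min (set_mset M))}"
  let ?S = "{S \<in> even_odd_Min_parts. \<Sum>S = n}"
  have bij: "bij_betw set_mset ?M ?S"
  proof (rule bij_betw_byWitness [where f' = mset_set])
    show "\<forall>M\<in>?M. mset_set (set_mset M) = M"
      using distinct_partition_eq(1) by blast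
    show "\<forall>S\<in>?S. set_mset (mset_set S) = S"
      by (auto simp: even_odd_Min_parts_def distinct_parts_def)
    show "set_mset ` ?M \<subseteq> ?S"
    proof safe
      fix M assume M: "M \<in> partitions n" "\<forall>k\<in>#M. count M k = 1" "even (size M)" "odd (Min (set_mset M))"
      have "size M = card (set_mset M)"
        by (metis distinct_partition_eq(1) [OF M(1,2)] size_mset_set)
      then show "set_mset M \<in> even_odd_Min_parts" "\<Sum>(set_mset M) = n"
        using M assms distinct_partition_eq(3) [OF M(1,2)]
        by (auto simp: even_odd_Min_parts_def distinct_parts_def partitions_def)
    qed
    show "mset_set ` ?S \<subseteq> ?M"
      by (auto simp: even_odd_Min_parts_def distinct_parts_def partitions_def sum_unfold_sum_mset)
  qed
  then show "p_do_e n = card ?S"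
    unfolding p_do_e_def by (rule bij_betw_same_card)
  show "finite ?S"
    using bij_betw_finite [OF bij] finite_p_do_e by blast
qed

text \<open>Double counting: slicing \<open>even_odd_Min_parts\<close> by the sum of the parts gives
  the counting series, and slicing by half the number of parts gives the explicit terms.\<close>

lemma p_do_e_gf:
  fixes q :: complex
  assumes "norm q < 1"
  shows "((\<lambda>j. q ^ (Suc (2 * j) choose 2) / (qpoch q q (2 * j) * (1 + q ^ (2 * j))))
    has_sum (\<Sum>\<^sub>\<infinity>n\<in>{1..}. of_nat (p_do_e n) * q ^ n)) {1..}"
proof -
  define s where "s = infsum (\<lambda>S. q ^ \<Sum>S) even_odd_Min_parts"
  have s: "((\<lambda>S. q ^ \<Sum>S) has_sum s) even_odd_Min_parts"
    unfolding s_def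
    by (intro has_sum_infsum summable_on_subset [OF summable_distinct_parts [OF assms]])
       (auto simp: even_odd_Min_parts_def)
  have "((\<lambda>n. of_nat (p_do_e n) * q ^ n) has_sum s) {1..}"
    using s
  proof (rule has_sum_fibres [where g = "\<lambda>S. \<Sum>S"])
    show "(\<lambda>S. \<Sum>S) ` even_odd_Min_parts \<subseteq> {1..}"
      by (fastforce simp: even_odd_Min_parts_def distinct_parts_def Suc_le_eq)
    fix n :: nat assume "n \<in> {1..}"
    then have "n > 0" by simp
    from p_do_e_eq_card [OF this]
    show "((\<lambda>S. q ^ \<Sum>S) has_sum of_nat (p_do_e n) * q ^ n) {S \<in> even_odd_Min_parts. \<Sum>S = n}"
      by (intro has_sum_finiteI) auto
  qed
  then have "s = (\<Sum>\<^sub>\<infinity>n\<in>{1..}. of_nat (p_do_e n) * q ^ n)"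
    by (simp add: infsumI)
  moreover have "((\<lambda>j. q ^ (Suc (2 * j) choose 2) / (qpoch q q (2 * j) * (1 + q ^ (2 * j))))
    has_sum s) {1..}"
    using s
  proof (rule has_sum_fibres [where g = "\<lambda>S. card S div 2"])
    show "(\<lambda>S. card S div 2) ` even_odd_Min_parts \<subseteq> {1..}"
    proof safe
      fix S :: "nat set" assume S: "S \<in> even_odd_Min_parts"
      then have "card S > 0" "even (card S)"
        by (auto simp: even_odd_Min_parts_def distinct_parts_def card_gt_0_iff)
      then show "card S div 2 \<ge> 1" by presburger
    qed
    fix j :: nat assume "j \<in> {1..}"
    then have j: "j \<ge> 1" by simp
    then have "{S \<in> even_odd_Min_parts. card S div 2 = j} =
        {S \<in> distinct_parts. card S = 2 * j \<and> odd (Min S)}"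
      by (auto simp: even_odd_Min_parts_def)
    then show "((\<lambda>S. q ^ \<Sum>S) has_sum
        q ^ (Suc (2 * j) choose 2) / (qpoch q q (2 * j) * (1 + q ^ (2 * j))))
        {S \<in> even_odd_Min_parts. card S div 2 = j}"
      using distinct_parts_odd_Min_gf [OF assms, of "2 * j"] j by simp
  qed
  ultimately show ?thesis by simp
qed

theorem theorem1p5:
  fixes q :: complex
  assumes "norm q < 1"
  shows "qpoch_inf (- q) q * phi (- q) =
           1 + 2 * (\<Sum>\<^sub>\<infinity>n\<in>{1..}. of_nat (p_do_e n) * q ^ n)"
proof -
  define p where "p = q\<^sup>2"
  define X where "X = (\<Sum>\<^sub>\<infinity>n\<in>{1..}. of_nat (p_do_e n) * q ^ n)"
  define r where "r = (\<lambda>j. q ^ (Suc (2 * j) choose 2) / (qpoch q q (2 * j) * (1 + q ^ (2 * j))))"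
  define a where "a = (\<lambda>j. p ^ (j * j) * inverse (qpoch p p j * (1 + p ^ j)) * q ^ j * qpoch_inf (q * p ^ j) p)"
  have p: "norm p < 1"
    using assms by (simp add: p_def norm_power power_less_one_iff)
  have "(r has_sum X) {1..}"
    unfolding r_def X_def by (rule p_do_e_gf [OF assms])
  \<comment> \<open>The added term \<open>r 0 = 1 / 2\<close> corresponds to no partition counted by
    \<open>p_do_e\<close>; doubled, it is the 1 of the theorem.\<close>
  then have "(r has_sum (r 0 + X)) (insert 0 {1..})"
    by (intro has_sum_insert) auto
  also have "insert 0 {1..} = (UNIV :: nat set)" by auto
  finally have "r sums (1 / 2 + X)"
    using has_sum_imp_sums by (fastforce simp: r_def numeral_2_eq_2)
  then have "(\<lambda>j. qpoch_inf q p * r j) sums (qpoch_inf q p * (1 / 2 + X))"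
    by (rule sums_mult)
  \<comment> \<open>The factor \<open>qpoch q p j\<close> of \<open>qpoch q q (2 * j)\<close>
    cancels against the infinite product and leaves its tail.\<close>
  moreover have "a j = qpoch_inf q p * r j" for j
  proof -
    have "qpoch_inf q p = qpoch q p j * qpoch_inf (q * p ^ j) p"
      by (rule qpoch_mult_qpoch_inf [OF p, symmetric])
    moreover have "qpoch q p j \<noteq> 0" by (rule qpoch_nonzero [OF p assms])
    moreover have "qpoch q q (2 * j) = qpoch q p j * qpoch p p j"
      unfolding p_def by (rule qpoch_double)
    moreover have "Suc (2 * j) choose 2 = 2 * (j * j) + j"
      by (induction j) (simp_all add: numeral_2_eq_2)
    then have "q ^ (Suc (2 * j) choose 2) = p ^ (j * j) * q ^ j" "q ^ (2 * j) = p ^ j"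
      by (simp_all add: p_def power_add flip: power_mult)
    ultimately show ?thesis
      by (simp add: a_def r_def divide_inverse)
  qed
  ultimately have "a sums (qpoch_inf q p * (1 / 2 + X))" by presburger
  then have "2 * suminf a = qpoch_inf q p * (1 + 2 * X)"
    by (simp add: sums_iff algebra_simps)
  moreover have "phi (- q) = 2 * suminf a"
  proof -
    have "(- q) ^ n\<^sup>2 = (- 1) ^ n * p ^ (n choose 2) * q ^ n" for n
    proof -
      have "n\<^sup>2 = 2 * (n choose 2) + n"
        by (induction n) (simp_all add: numeral_2_eq_2)
      then have "(- q) ^ n\<^sup>2 = ((- q)\<^sup>2) ^ (n choose 2) * (- q) ^ n"
        by (simp only: power_add power_mult)
      then show ?thesis
        by (simp add: p_def power_minus [of q n])
    qed
    then have "phi (- q) = (\<Sum>n. (- 1) ^ n * p ^ (n choose 2) * inverse (qpoch (- p) p n) * q ^ n)"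
      by (simp add: phi_def p_def divide_inverse mult_ac)
    then show ?thesis
      unfolding a_def using mock_theta_transformation [OF p, of q] assms by simp
  qed
  ultimately have "qpoch_inf (- q) q * phi (- q) = qpoch_inf (- q) q * qpoch_inf q (q\<^sup>2) * (1 + 2 * X)"
    by (simp add: p_def mult_ac)
  then show ?thesis
    by (simp add: euler_odd_distinct [OF assms] X_def)
qed

end
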